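(* Let $k$ be a field of characteristic $p>0$, let $n\ge1$, and let $A(T)\in\mathrm{Mat}(n,k[T])$ be an exponential matrix. Then there exists a regular matrix $P\in GL(n,k)$ such that $P^{-1}A(T)P$ is an upper triangular matrix of $\mathrm{Mat}(n,k[T])$.
   Context: $k[T]$ is the polynomial ring in one variable over $k$. A matrix $A(T)\in\mathrm{Mat}(n,k[T])$ is exponential if $A(0)=I_n$ and $A(T)A(T')=A(T+T')$, where $T,T'$ are indeterminates over $k$. *)

theory Defs
  imports
    "HOL-Computational_Algebra.Computational_Algebra"
    "Jordan_Normal_Form.Matrix"
begin

text \<open>The ring \<open>k[T, T']\<close> is \<open>(k[T])[T']\<close>, i.e.\ the type \<open>'a poly poly\<close> whose outer
  variable is \<open>T'\<close>.\<close>

definition indet_T :: "'a::comm_ring_1 poly poly" where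
  "indet_T = [:[:0, 1:]:]"

definition indet_T' :: "'a::comm_ring_1 poly poly" where
  "indet_T' = [:0, 1:]"

text \<open>\<open>mat_subst f A\<close> is the matrix \<open>A(f)\<close> over \<open>k[T, T']\<close> obtained from \<open>A(T)\<close> by
  substituting \<open>f\<close> for the variable in every entry.\<close>

definition mat_subst :: "'a::comm_ring_1 poly poly \<Rightarrow> 'a poly mat \<Rightarrow> 'a poly poly mat" where
  "mat_subst f A = map_mat (\<lambda>q. poly (map_poly (\<lambda>c. [:[:c:]:]) q) f) A"

definition exponential_mat :: "nat \<Rightarrow> 'a::comm_ring_1 poly mat \<Rightarrow> bool" where
  "exponential_mat n A \<longleftrightarrow>
     A \<in> carrier_mat n n \<and>
     map_mat (\<lambda>q. poly q 0) A = 1\<^sub>m n \<and>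
     mat_subst indet_T A * mat_subst indet_T' A = mat_subst (indet_T + indet_T') A"

abbreviation const_mat :: "'a::comm_ring_1 mat \<Rightarrow> 'a poly mat" where
  "const_mat \<equiv> map_mat (\<lambda>c. [:c:])"

end

theory Submission
  imports
    Defs
    "Jordan_Normal_Form.Schur_Decomposition"
    "Jordan_Normal_Form.DL_Rank"
begin

text \<open>
  Write \<open>A(T) = \<Sum>\<^sub>i T\<^sup>i A\<^sub>i\<close>. Comparing coefficients, exponentiality says \<open>A\<^sub>0 = I\<close> and
  \<open>A\<^sub>i A\<^sub>j = (i + j choose i) A\<^sub>i\<^sub>+\<^sub>j\<close>. For \<open>v \<noteq> 0\<close> take the largest \<open>m\<close> with \<open>A\<^sub>m v \<noteq> 0\<close>; then
  \<open>w = A\<^sub>m v\<close> is killed by every \<open>A\<^sub>j\<close> with \<open>j > 0\<close>. Completing \<open>w\<close> to a basis makes all the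
  \<open>A\<^sub>i\<close> block upper triangular with a \<open>1 \<times> 1\<close> first block, and the lower right blocks satisfy
  the same relations, so one concludes by induction on \<open>n\<close>.
\<close>

section \<open>Coefficients of polynomials and matrices under the substitutions of \<open>T\<close>,
  \<open>T'\<close> and \<open>T + T'\<close>\<close>

lemma poly_map_const_indet_T:
  "poly (map_poly (\<lambda>c. [:[:c:]:]) q) indet_T = [:q:]"
  by (induction q) (simp_all add: map_poly_pCons indet_T_def)

lemma poly_map_const_indet_T':
  "poly (map_poly (\<lambda>c. [:[:c:]:]) q) indet_T' = map_poly (\<lambda>c. [:c:]) q"
  by (induction q) (simp_all add: map_poly_pCons indet_T'_def)

text \<open>This is the binomial theorem for \<open>(T + T')^(i + j)\<close>; the outer index
  \<open>j\<close> counts \<open>T'\<close>, the inner index \<open>i\<close> counts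
  \<open>T\<close>. Passing from \<open>q\<close> to \<open>a + T q\<close> multiplies the
  substituted polynomial by \<open>T + T'\<close>, so the inductive step is Pascal's rule.\<close>

lemma coeff_poly_map_const_indet_add:
  "coeff (coeff (poly (map_poly (\<lambda>c. [:[:c:]:]) q) (indet_T + indet_T')) j) i
     = of_nat (i + j choose i) * coeff q (i + j)"
proof (induction q arbitrary: i j)
  case 0
  then show ?case by simp
next
  case (pCons a q)
  then show ?case
    by (cases i; cases j)
       (simp_all add: map_poly_pCons indet_T_def indet_T'_def coeff_pCons algebra_simps)
qed

text \<open>Both sides are the coefficient of \<open>T^i T'^j\<close> in the identity
  \<open>hom\<close>: the two factors involve different variables, so on the left only one product
  of coefficients survives.\<close>

lemma coeff_mats_mult:
  fixes A :: "'a::comm_ring_1 poly mat"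
  assumes A: "A \<in> carrier_mat n n"
    and hom: "mat_subst indet_T A * mat_subst indet_T' A = mat_subst (indet_T + indet_T') A"
  shows "map_mat (\<lambda>q. coeff q i) A * map_mat (\<lambda>q. coeff q j) A
           = of_nat (i + j choose i) \<cdot>\<^sub>m map_mat (\<lambda>q. coeff q (i + j)) A"
    (is "?L = ?R")
proof (rule eq_matI)
  show "dim_row ?L = dim_row ?R" "dim_col ?L = dim_col ?R" using A by auto
  fix r s assume "r < dim_row ?R" "s < dim_col ?R"
  then have rs: "r < n" "s < n" using A by auto
  have "?L $$ (r, s) = coeff (coeff ((mat_subst indet_T A * mat_subst indet_T' A) $$ (r, s)) j) i"
    using rs A
    by (simp add: mat_subst_def poly_map_const_indet_T poly_map_const_indet_T' scalar_prod_def
        coeff_sum coeff_map_poly mult.commute)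
  also have "\<dots> = ?R $$ (r, s)"
    unfolding hom using rs A by (simp add: mat_subst_def coeff_poly_map_const_indet_add)
  finally show "?L $$ (r, s) = ?R $$ (r, s)" .
qed

text \<open>Taking a coefficient is linear over constants. Hence triangularizing all coefficient
  matrices with one \<open>P\<close> triangularizes the polynomial matrix.\<close>

lemma coeff_mat_conjugate:
  fixes A :: "'a::comm_ring_1 poly mat"
  assumes "A \<in> carrier_mat n n" "P \<in> carrier_mat n n" "Q \<in> carrier_mat n n"
  shows "map_mat (\<lambda>q. coeff q i) (const_mat Q * A * const_mat P)
           = Q * map_mat (\<lambda>q. coeff q i) A * P"
  using assms
  by (intro eq_matI) (auto simp: scalar_prod_def coeff_sum mult.commute[of _ "[:_:]"] mult.commute)

section \<open>Completion of a vector to a basis, and block upper triangular matrices\<close>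

lemma exists_invertible_mat_with_col_0:
  fixes v :: "'a::field vec"
  assumes v: "v \<in> carrier_vec n" "v \<noteq> 0\<^sub>v n"
  obtains P Q where "P \<in> carrier_mat n n" "Q \<in> carrier_mat n n"
    "P * Q = 1\<^sub>m n" "Q * P = 1\<^sub>m n" "col P 0 = v"
proof -
  interpret vec_space "TYPE('a)" n .
  note bc = basis_completion[OF v]
  define P where "P = mat_of_cols n (basis_completion v)"
  have P: "P \<in> carrier_mat n n" unfolding P_def using bc(6) by auto
  have cols: "cols P = basis_completion v" unfolding P_def using bc(2) by simp
  have "rank P = n" using lin_indpt_full_rank[OF P] bc(4,5) by (simp add: cols)
  then have "det P \<noteq> 0" using det_rank_iff[OF P] by simp
  then obtain Q where "Q \<in> carrier_mat n n" "P * Q = 1\<^sub>m n" "Q * P = 1\<^sub>m n"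
    using det_non_zero_imp_unit[OF P, of n] unfolding Units_def
    by (auto simp: ring_mat_def)
  moreover have "col P 0 = v"
  proof -
    \<comment> \<open>In dimension 0 every vector is zero. So the completed basis is a nonempty
      list, and its head \<open>v\<close> is column 0.\<close>
    have "n \<noteq> 0" using v by auto
    then show ?thesis
      using bc(6,7) P cols
      by (metis carrier_matD(2) cols_length cols_nth gr0I hd_conv_nth length_0_conv)
  qed
  ultimately show thesis using that P by blast
qed

definition lower_right :: "nat \<Rightarrow> 'a mat \<Rightarrow> 'a mat" where
  "lower_right n M = mat n n (\<lambda>(i, j). M $$ (Suc i, Suc j))"

lemma lower_right_carrier [simp]: "lower_right n M \<in> carrier_mat n n"
  by (simp add: lower_right_def)

lemma lower_right_four_block_mat:
  assumes "X \<in> carrier_mat 1 1" "D \<in> carrier_mat n n"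
  shows "lower_right n (four_block_mat X R C D) = D"
  using assms by (intro eq_matI) (auto simp: lower_right_def)

lemma four_block_mat_lower_right:
  fixes M :: "'a::zero mat"
  assumes M: "M \<in> carrier_mat (Suc n) (Suc n)"
    and col: "\<And>i. i < n \<Longrightarrow> M $$ (Suc i, 0) = 0"
  obtains X R where "X \<in> carrier_mat 1 1" "R \<in> carrier_mat 1 n"
    "M = four_block_mat X R (0\<^sub>m n 1) (lower_right n M)"
proof -
  let ?X = "mat 1 1 (\<lambda>_. M $$ (0, 0))" and ?R = "mat 1 n (\<lambda>(i, j). M $$ (0, Suc j))"
  have "M = four_block_mat ?X ?R (0\<^sub>m n 1) (lower_right n M)"
  proof (rule eq_matI)
    fix i j assume "i < dim_row (four_block_mat ?X ?R (0\<^sub>m n 1) (lower_right n M))"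
      and "j < dim_col (four_block_mat ?X ?R (0\<^sub>m n 1) (lower_right n M))"
    then show "M $$ (i, j) = four_block_mat ?X ?R (0\<^sub>m n 1) (lower_right n M) $$ (i, j)"
      using col by (cases i; cases j) (auto simp: lower_right_def)
  qed (use M in \<open>auto simp: lower_right_def\<close>)
  then show thesis using that[of ?X ?R] by simp
qed

text \<open>The zeros in column 0 say that the first basis vector spans an invariant line. The lower
  right block is the induced map on the quotient by that line, hence multiplicative.\<close>

lemma lower_right_mult:
  fixes M N :: "'a::semiring_1 mat"
  assumes M: "M \<in> carrier_mat (Suc n) (Suc n)" "\<And>i. i < n \<Longrightarrow> M $$ (Suc i, 0) = 0"
    and N: "N \<in> carrier_mat (Suc n) (Suc n)" "\<And>i. i < n \<Longrightarrow> N $$ (Suc i, 0) = 0"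
  shows "lower_right n (M * N) = lower_right n M * lower_right n N"
proof -
  obtain X R where XR: "X \<in> carrier_mat 1 1" "R \<in> carrier_mat 1 n"
    "M = four_block_mat X R (0\<^sub>m n 1) (lower_right n M)"
    using four_block_mat_lower_right[OF M] by blast
  obtain Y S where YS: "Y \<in> carrier_mat 1 1" "S \<in> carrier_mat 1 n"
    "N = four_block_mat Y S (0\<^sub>m n 1) (lower_right n N)"
    using four_block_mat_lower_right[OF N] by blast
  show ?thesis
    using XR(1,2) YS(1,2)
    by (subst XR(3), subst YS(3), subst mult_four_block_mat[of _ 1 1 _ n _ n _ _ 1 _ n])
       (auto simp: lower_right_four_block_mat left_add_zero_mat[of _ n n]
        mult_carrier_mat[of _ n n _ n])
qed

section \<open>Simultaneous triangularization of the coefficient matrices\<close>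

lemma exists_common_kernel_vec:
  fixes A :: "nat \<Rightarrow> 'a::comm_ring_1 mat"
  assumes A: "\<And>i. A i \<in> carrier_mat n n"
    and A0: "A 0 = 1\<^sub>m n"
    and mult: "\<And>i j. A i * A j = c i j \<cdot>\<^sub>m A (i + j)"
    and zero: "\<And>i. i > d \<Longrightarrow> A i = 0\<^sub>m n n"
    and "n > 0"
  obtains w where "w \<in> carrier_vec n" "w \<noteq> 0\<^sub>v n" "\<And>j. j > 0 \<Longrightarrow> A j *\<^sub>v w = 0\<^sub>v n"
proof -
  let ?v = "unit_vec n 0 :: 'a vec"
  let ?I = "{i. A i *\<^sub>v ?v \<noteq> 0\<^sub>v n}"
  have "?v $ 0 \<noteq> 0\<^sub>v n $ 0" using \<open>n > 0\<close> by simp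
  \<comment> \<open>The index set is nonempty because \<open>A 0\<close> is the identity, and it is
    bounded by \<open>d\<close>; this makes its maximum meaningful.\<close>
  then have "0 \<in> ?I" using A0 by auto
  have "?I \<subseteq> {..d}" using zero by (force simp: not_le[symmetric])
  then have fin: "finite ?I" by (rule finite_subset) simp
  define m where "m = Max ?I"
  have "m \<in> ?I" unfolding m_def using fin \<open>0 \<in> ?I\<close> by (intro Max_in) auto
  have "A j *\<^sub>v (A m *\<^sub>v ?v) = 0\<^sub>v n" if "j > 0" for j
  proof -
    \<comment> \<open>Maximality of \<open>m\<close> kills \<open>A (j + m)\<close> on
      \<open>?v\<close>, and \<open>A j * A m\<close> is a scalar multiple of that matrix.\<close>
    have "j + m \<notin> ?I" using Max_ge[OF fin, of "j + m"] that unfolding m_def[symmetric] by auto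
    then have "A (j + m) *\<^sub>v ?v = 0\<^sub>v n" by simp
    moreover have "A j *\<^sub>v (A m *\<^sub>v ?v) = c j m \<cdot>\<^sub>v (A (j + m) *\<^sub>v ?v)"
      using A[of j] A[of m] A[of "j + m"]
      by (subst assoc_mult_mat_vec[symmetric, of _ n n _ n])
         (auto simp: mult intro!: eq_vecI)
    ultimately show ?thesis by auto
  qed
  moreover have "A m *\<^sub>v ?v \<in> carrier_vec n" using A by (intro mult_mat_vec_carrier) auto
  ultimately show thesis using that[of "A m *\<^sub>v ?v"] \<open>m \<in> ?I\<close> by auto
qed

text \<open>The hypotheses survive conjugation and passage to the quotient by a common invariant
  line, with the same \<open>c\<close> and \<open>d\<close>; this is what lets the induction on
  \<open>n\<close> run with only \<open>A\<close> generalized.\<close>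

lemma simultaneous_triangularization_graded:
  fixes A :: "nat \<Rightarrow> 'a::field mat"
  assumes "\<And>i. A i \<in> carrier_mat n n"
    and "A 0 = 1\<^sub>m n"
    and "\<And>i j. A i * A j = c i j \<cdot>\<^sub>m A (i + j)"
    and "\<And>i. i > d \<Longrightarrow> A i = 0\<^sub>m n n"
  shows "\<exists>P Q. P \<in> carrier_mat n n \<and> Q \<in> carrier_mat n n \<and> P * Q = 1\<^sub>m n \<and> Q * P = 1\<^sub>m n \<and>
           (\<forall>i. upper_triangular (Q * A i * P))"
  using assms
proof (induction n arbitrary: A)
  case 0
  then show ?case
    by (intro exI[of _ "1\<^sub>m 0"]) (auto simp: upper_triangular_def)
next
  case (Suc n)
  let ?n = "Suc n"
  note A = Suc.prems(1) and mult = Suc.prems(3)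
  obtain w where w: "w \<in> carrier_vec ?n" "w \<noteq> 0\<^sub>v ?n" "\<And>j. j > 0 \<Longrightarrow> A j *\<^sub>v w = 0\<^sub>v ?n"
    using exists_common_kernel_vec[OF Suc.prems] by blast
  obtain P Q where PQ: "P \<in> carrier_mat ?n ?n" "Q \<in> carrier_mat ?n ?n"
    "P * Q = 1\<^sub>m ?n" "Q * P = 1\<^sub>m ?n" and col_P: "col P 0 = w"
    using exists_invertible_mat_with_col_0[OF w(1,2)] by blast
  define B where "B i = Q * A i * P" for i
  have B: "B i \<in> carrier_mat ?n ?n" for i
    unfolding B_def using A PQ by (intro mult_carrier_mat) auto
  have B0: "B 0 = 1\<^sub>m ?n" unfolding B_def Suc.prems(2) using PQ by simp
  have B_mult: "B i * B j = c i j \<cdot>\<^sub>m B (i + j)" for i j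
  proof -
    have "B i * B j = Q * A i * (P * Q) * A j * P"
      unfolding B_def using A[of i] A[of j] PQ(1,2)
      by (simp add: assoc_mult_mat[of _ ?n ?n _ ?n _ ?n] mult_carrier_mat[of _ ?n ?n _ ?n])
    also have "\<dots> = Q * (A i * A j) * P"
      using A[of i] A[of j] PQ
      by (simp add: assoc_mult_mat[of _ ?n ?n _ ?n _ ?n] mult_carrier_mat[of _ ?n ?n _ ?n])
    also have "\<dots> = c i j \<cdot>\<^sub>m B (i + j)"
      unfolding B_def mult using A[of "i + j"] PQ
      by (simp add: mult_smult_distrib[of _ ?n ?n _ ?n] mult_smult_assoc_mat[of _ ?n ?n _ ?n])
    finally show ?thesis .
  qed
  \<comment> \<open>Column 0 of \<open>B i\<close> is \<open>Q (A i w)\<close>, which vanishes for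
    \<open>i > 0\<close>. The index 0 is separate, since \<open>A 0\<close> fixes \<open>w\<close>;
    there \<open>B 0\<close> is the identity.\<close>
  have col_B: "B i $$ (Suc r, 0) = 0" if "r < n" for i r
  proof (cases "i = 0")
    case True
    then show ?thesis using B0 that by simp
  next
    case False
    have "col (B i) 0 = (Q * A i) *\<^sub>v col P 0"
      unfolding B_def using PQ A by (intro col_mult2[of _ ?n ?n _ ?n]) auto
    also have "\<dots> = Q *\<^sub>v (A i *\<^sub>v w)"
      unfolding col_P using PQ A w(1) by (intro assoc_mult_mat_vec) auto
    also have "\<dots> = 0\<^sub>v ?n" using w(3) False PQ(2) by auto
    finally have "col (B i) 0 $ Suc r = 0\<^sub>v ?n $ Suc r" by simp
    then show ?thesis using that B[of i] by simp
  qed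
  let ?D = "\<lambda>i. lower_right n (B i)"
  have "\<exists>P Q. P \<in> carrier_mat n n \<and> Q \<in> carrier_mat n n \<and> P * Q = 1\<^sub>m n \<and> Q * P = 1\<^sub>m n \<and>
           (\<forall>i. upper_triangular (Q * ?D i * P))"
  proof (rule Suc.IH)
    show "?D 0 = 1\<^sub>m n" unfolding B0 by (intro eq_matI) (auto simp: lower_right_def)
    show "?D i * ?D j = c i j \<cdot>\<^sub>m ?D (i + j)" for i j
    proof -
      have "?D i * ?D j = lower_right n (B i * B j)"
        using lower_right_mult[OF B col_B B col_B] by simp
      also have "\<dots> = c i j \<cdot>\<^sub>m ?D (i + j)"
        unfolding B_mult using B[of "i + j"] by (intro eq_matI) (auto simp: lower_right_def)
      finally show ?thesis .
    qed
    show "?D i = 0\<^sub>m n n" if "i > d" for i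
      unfolding B_def Suc.prems(4)[OF that] using PQ
      by (intro eq_matI) (auto simp: lower_right_def)
  qed simp
  then obtain P' Q' where PQ': "P' \<in> carrier_mat n n" "Q' \<in> carrier_mat n n"
    "P' * Q' = 1\<^sub>m n" "Q' * P' = 1\<^sub>m n" and ut: "\<And>i. upper_triangular (Q' * ?D i * P')"
    by blast
  \<comment> \<open>\<open>E\<close> extends a change of basis of the quotient to the whole space,
    fixing the first basis vector. Conjugation by it keeps the corner and the zeros below it, and
    acts on the lower right block as wanted.\<close>
  define E where "E M = four_block_mat (1\<^sub>m 1) (0\<^sub>m 1 n) (0\<^sub>m n 1) M" for M :: "'a mat"
  have E: "E M \<in> carrier_mat ?n ?n" if "M \<in> carrier_mat n n" for M
    using four_block_carrier_mat[of "1\<^sub>m 1" 1 1 M n n] that unfolding E_def by simp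
  have E_mult: "E M * four_block_mat X R (0\<^sub>m n 1) D * E N
      = four_block_mat X (R * N) (0\<^sub>m n 1) (M * D * N)"
    if "M \<in> carrier_mat n n" "N \<in> carrier_mat n n" "D \<in> carrier_mat n n"
      "X \<in> carrier_mat 1 1" "R \<in> carrier_mat 1 n" for M N X R D
    using that unfolding E_def
    by (simp add: mult_four_block_mat[of _ 1 1 _ n _ n _ _ 1 _ n] mult_carrier_mat[of _ n n _ n]
        mult_carrier_mat[of _ 1 n _ n] left_add_zero_mat[of _ 1 n] left_add_zero_mat[of _ n n])
  have E_inv: "E M * E N = 1\<^sub>m ?n"
    if "M \<in> carrier_mat n n" "N \<in> carrier_mat n n" "M * N = 1\<^sub>m n" for M N
    using that unfolding E_def
    by (simp add: mult_four_block_mat[of _ 1 1 _ n _ n _ _ 1 _ n])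
  have inv: "(U * V) * (V' * U') = 1\<^sub>m ?n"
    if "U \<in> carrier_mat ?n ?n" "V \<in> carrier_mat ?n ?n" "U' \<in> carrier_mat ?n ?n"
      "V' \<in> carrier_mat ?n ?n" "V * V' = 1\<^sub>m ?n" "U * U' = 1\<^sub>m ?n" for U V U' V' :: "'a mat"
  proof -
    have "(U * V) * (V' * U') = U * (V * V') * U'"
      using that(1-4)
      by (simp add: assoc_mult_mat[of _ ?n ?n _ ?n _ ?n] mult_carrier_mat[of _ ?n ?n _ ?n])
    then show ?thesis using that by simp
  qed
  \<comment> \<open>The witnesses compose the two changes of basis: \<open>P\<close> moves
    \<open>w\<close> to the front, then \<open>E P'\<close> triangularizes the quotient.\<close>
  have "upper_triangular ((E Q' * Q) * A i * (P * E P'))" for i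
  proof -
    have "(E Q' * Q) * A i * (P * E P') = E Q' * B i * E P'"
      unfolding B_def using A[of i] PQ(1,2) E[OF PQ'(1)] E[OF PQ'(2)]
      by (simp add: assoc_mult_mat[of _ ?n ?n _ ?n _ ?n] mult_carrier_mat[of _ ?n ?n _ ?n])
    moreover obtain X R where XR: "X \<in> carrier_mat 1 1" "R \<in> carrier_mat 1 n"
      "B i = four_block_mat X R (0\<^sub>m n 1) (?D i)"
      using four_block_mat_lower_right[OF B col_B] by blast
    ultimately have "(E Q' * Q) * A i * (P * E P')
        = four_block_mat X (R * P') (0\<^sub>m n 1) (Q' * ?D i * P')"
      using E_mult[OF PQ'(2,1) lower_right_carrier XR(1,2), of "B i"] XR(3) by simp
    moreover have "upper_triangular (four_block_mat X (R * P') (0\<^sub>m n 1) (Q' * ?D i * P'))"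
      using XR(1) PQ' ut
      by (intro upper_triangular_four_block[of _ 1]) (auto simp: upper_triangular_def)
    ultimately show ?thesis by simp
  qed
  moreover have "P * E P' * (E Q' * Q) = 1\<^sub>m ?n" "E Q' * Q * (P * E P') = 1\<^sub>m ?n"
    using PQ PQ' E E_inv by (auto intro!: inv)
  moreover have "P * E P' \<in> carrier_mat ?n ?n" "E Q' * Q \<in> carrier_mat ?n ?n"
    using PQ PQ' E by (auto intro!: mult_carrier_mat)
  ultimately show ?case by blast
qed

theorem lemma1p8:
  fixes A :: "'k::field poly mat" and n p :: nat
  assumes "CHAR('k) = p" and "p > 0"
    and "n \<ge> 1"
    and "exponential_mat n A"
  shows "\<exists>P Q :: 'k mat. P \<in> carrier_mat n n \<and> Q \<in> carrier_mat n n \<and>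
           inverts_mat P Q \<and> inverts_mat Q P \<and>
           upper_triangular (const_mat Q * A * const_mat P)"
proof -
  have A: "A \<in> carrier_mat n n" and A_0: "map_mat (\<lambda>q. poly q 0) A = 1\<^sub>m n"
    and hom: "mat_subst indet_T A * mat_subst indet_T' A = mat_subst (indet_T + indet_T') A"
    using assms(4) unfolding exponential_mat_def by auto
  let ?C = "\<lambda>i. map_mat (\<lambda>q. coeff q i) A"
  \<comment> \<open>The largest degree of an entry bounds the indices of the nonzero coefficient
    matrices.\<close>
  define d where "d = Max (degree ` elements_mat A)"
  have "\<exists>P Q. P \<in> carrier_mat n n \<and> Q \<in> carrier_mat n n \<and> P * Q = 1\<^sub>m n \<and> Q * P = 1\<^sub>m n \<and>
           (\<forall>i. upper_triangular (Q * ?C i * P))"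
  proof (rule simultaneous_triangularization_graded)
    show "?C i \<in> carrier_mat n n" for i using A by simp
    show "?C 0 = 1\<^sub>m n" using A_0 by (simp add: poly_0_coeff_0)
    show "?C i * ?C j = of_nat (i + j choose i) \<cdot>\<^sub>m ?C (i + j)" for i j
      by (rule coeff_mats_mult[OF A hom])
    show "?C i = 0\<^sub>m n n" if "i > d" for i
    proof (rule eq_matI)
      fix r s assume rs: "r < dim_row (0\<^sub>m n n)" "s < dim_col (0\<^sub>m n n)"
      have "finite (elements_mat A)" unfolding elements_mat_def by auto
      moreover have "A $$ (r, s) \<in> elements_mat A" using rs A by auto
      ultimately have "degree (A $$ (r, s)) \<le> d" unfolding d_def by simp
      then show "?C i $$ (r, s) = 0\<^sub>m n n $$ (r, s)"
        using rs A that by (simp add: coeff_eq_0)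
    qed (use A in auto)
  qed
  then obtain P Q where PQ: "P \<in> carrier_mat n n" "Q \<in> carrier_mat n n"
    "P * Q = 1\<^sub>m n" "Q * P = 1\<^sub>m n" and ut: "\<And>i. upper_triangular (Q * ?C i * P)"
    by blast
  have "upper_triangular (const_mat Q * A * const_mat P)" (is "upper_triangular ?M")
  proof (rule upper_triangularI)
    fix r s assume rs: "s < r" "r < dim_row ?M"
    have dims: "dim_row ?M = n" "dim_col ?M = n" using PQ by auto
    \<comment> \<open>A polynomial entry below the diagonal is zero once each of its coefficients
      is, and these are entries of the triangular matrices \<open>Q * ?C i * P\<close>.\<close>
    have "coeff (?M $$ (r, s)) i = 0" for i
    proof -
      have "coeff (?M $$ (r, s)) i = map_mat (\<lambda>q. coeff q i) ?M $$ (r, s)"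
        using rs dims by simp
      also have "\<dots> = (Q * ?C i * P) $$ (r, s)"
        by (simp only: coeff_mat_conjugate[OF A PQ(1,2)])
      also have "\<dots> = 0" using upper_triangularD[OF ut rs(1)] rs(2) dims PQ by simp
      finally show ?thesis .
    qed
    then show "?M $$ (r, s) = 0" by (simp add: poly_eq_iff)
  qed
  then show ?thesis using PQ unfolding inverts_mat_def by auto
qed

end
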